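(* Let $\mathcal{H}$ be a complex Hilbert space of dimension $d\ge 1$ with orthonormal bases $\mathcal{A}=\{|a_i\rangle\}_{i=0}^{d-1}$ and $\mathcal{B}=\{|b_j\rangle\}_{j=0}^{d-1}$ such that $|\langle a_i|b_j\rangle|=\frac{1}{\sqrt d}$ for all $i,j\in\{0,\dots,d-1\}$. Let $|\psi\rangle\in\mathcal{H}$ be a state that is not (up to a global phase) a basis vector of $\mathcal{A}$ or of $\mathcal{B}$. If $n_{\mathcal{A}}(\psi)>\frac d2$ or $n_{\mathcal{B}}(\psi)>\frac d2$, then $|\psi\rangle$ is KD nonclassical with respect to $\mathcal{A},\mathcal{B}$.
   Context: A state is a unit vector $|\psi\rangle\in\mathcal{H}$. Its Kirkwood-Dirac (KD) distribution with respect to the orthonormal bases $\mathcal{A},\mathcal{B}$ is $Q_{ij}=\langle a_i|\psi\rangle\langle\psi|b_j\rangle\langle b_j|a_i\rangle$ for $i,j\in\{0,\dots,d-1\}$ (complex numbers in general). The state is called KD classical if every $Q_{ij}$ is real and nonnegative, and KD nonclassical otherwise. The support sizes are $n_{\mathcal{A}}(\psi)=|\{i:\langle a_i|\psi\rangle\neq 0\}|$ and $n_{\mathcal{B}}(\psi)=|\{j:\langle b_j|\psi\rangle\neq 0\}|$. *)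

theory Defs
  imports "HOL-Analysis.Analysis"
begin

(* Inner products follow the bra-ket convention: "cinner x y" stands for <x|y>,
   conjugate-linear in x and linear in y. *)

class complex_hilbert_space = banach +
  fixes scaleC :: "complex \<Rightarrow> 'a \<Rightarrow> 'a"  (infixr "*\<^sub>C" 75)
    and cinner :: "'a \<Rightarrow> 'a \<Rightarrow> complex"
  assumes scaleC_add_right: "c *\<^sub>C (x + y) = c *\<^sub>C x + c *\<^sub>C y"
    and scaleC_add_left: "(b + c) *\<^sub>C x = b *\<^sub>C x + c *\<^sub>C x"
    and scaleC_scaleC: "b *\<^sub>C (c *\<^sub>C x) = (b * c) *\<^sub>C x"
    and scaleR_scaleC: "r *\<^sub>R x = complex_of_real r *\<^sub>C x"
    and cinner_commute: "cinner x y = cnj (cinner y x)"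
    and cinner_add_right: "cinner x (y + z) = cinner x y + cinner x z"
    and cinner_scaleC_right: "cinner x (c *\<^sub>C y) = c * cinner x y"
    and cinner_self: "cinner x x = complex_of_real ((norm x)\<^sup>2)"

lemma scaleC_one: "1 *\<^sub>C x = (x :: 'a :: complex_hilbert_space)"
  using scaleR_scaleC[of 1 x] by simp

global_interpretation complex_vector:
  vector_space "scaleC :: complex \<Rightarrow> 'a \<Rightarrow> 'a :: complex_hilbert_space"
  defines cspan = complex_vector.span
    and cdim = complex_vector.dim
  by unfold_locales
    (simp_all add: scaleC_add_right scaleC_add_left scaleC_scaleC scaleC_one)

instantiation complex :: complex_hilbert_space
begin
definition scaleC_complex :: "complex \<Rightarrow> complex \<Rightarrow> complex"
  where "scaleC_complex c x = c * x"
definition cinner_complex :: "complex \<Rightarrow> complex \<Rightarrow> complex"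
  where "cinner_complex x y = cnj x * y"
instance
proof
  fix x y :: complex
  show "cinner x x = complex_of_real ((norm x)\<^sup>2)"
    unfolding cinner_complex_def complex_norm_square by (rule mult.commute)
qed (simp_all add: scaleC_complex_def cinner_complex_def distrib_left distrib_right
      scaleR_conv_of_real)
end

instantiation vec :: (complex_hilbert_space, finite) complex_hilbert_space
begin
definition scaleC_vec :: "complex \<Rightarrow> 'a ^ 'b \<Rightarrow> 'a ^ 'b"
  where "scaleC_vec c x = (\<chi> i. c *\<^sub>C (x $ i))"
definition cinner_vec :: "'a ^ 'b \<Rightarrow> 'a ^ 'b \<Rightarrow> complex"
  where "cinner_vec x y = (\<Sum>i\<in>UNIV. cinner (x $ i) (y $ i))"
instance
proof
  fix x y :: "'a ^ 'b"
  show "cinner x y = cnj (cinner y x)"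
    unfolding cinner_vec_def cnj_sum by (intro sum.cong refl cinner_commute)
  show "cinner x x = complex_of_real ((norm x)\<^sup>2)"
    by (simp add: cinner_vec_def cinner_self norm_vec_def L2_set_def sum_nonneg)
qed (simp_all add: scaleC_vec_def cinner_vec_def vec_eq_iff scaleC_add_right scaleC_add_left
      scaleC_scaleC scaleR_scaleC cinner_add_right cinner_scaleC_right sum.distrib
      sum_distrib_left)
end

definition orthonormal_basis :: "nat \<Rightarrow> (nat \<Rightarrow> 'a :: complex_hilbert_space) \<Rightarrow> bool"
  where "orthonormal_basis d a \<longleftrightarrow>
    (\<forall>i<d. \<forall>j<d. cinner (a i) (a j) = (if i = j then 1 else 0)) \<and>
    cspan (a ` {..<d}) = UNIV"

definition eq_up_to_phase :: "'a :: complex_hilbert_space \<Rightarrow> 'a \<Rightarrow> bool"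
  where "eq_up_to_phase x y \<longleftrightarrow> (\<exists>c. cmod c = 1 \<and> x = c *\<^sub>C y)"

definition kd_distribution ::
  "(nat \<Rightarrow> 'a) \<Rightarrow> (nat \<Rightarrow> 'a) \<Rightarrow> 'a :: complex_hilbert_space \<Rightarrow> nat \<Rightarrow> nat \<Rightarrow> complex"
  where "kd_distribution a b \<psi> i j = cinner (a i) \<psi> * cinner \<psi> (b j) * cinner (b j) (a i)"

definition kd_classical ::
  "nat \<Rightarrow> (nat \<Rightarrow> 'a) \<Rightarrow> (nat \<Rightarrow> 'a) \<Rightarrow> 'a :: complex_hilbert_space \<Rightarrow> bool"
  where "kd_classical d a b \<psi> \<longleftrightarrow>
    (\<forall>i<d. \<forall>j<d. kd_distribution a b \<psi> i j \<in> \<real> \<and> 0 \<le> Re (kd_distribution a b \<psi> i j))"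

definition kd_nonclassical ::
  "nat \<Rightarrow> (nat \<Rightarrow> 'a) \<Rightarrow> (nat \<Rightarrow> 'a) \<Rightarrow> 'a :: complex_hilbert_space \<Rightarrow> bool"
  where "kd_nonclassical d a b \<psi> \<longleftrightarrow> \<not> kd_classical d a b \<psi>"

definition support_size :: "nat \<Rightarrow> (nat \<Rightarrow> 'a) \<Rightarrow> 'a :: complex_hilbert_space \<Rightarrow> nat"
  where "support_size d a \<psi> = card {i. i < d \<and> cinner (a i) \<psi> \<noteq> 0}"

end

theory Submission
  imports Defs
begin

text \<open>
  For a KD classical state every entry of the distribution equals its modulus, which is
  \<open>\<bar>\<alpha> i\<bar> * \<bar>\<beta> j\<bar> / sqrt d\<close> for the coefficients \<open>\<alpha>\<close>, \<open>\<beta>\<close> of the state in the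
  two bases. Summing over \<open>j\<close>, Parseval gives \<open>\<bar>\<alpha> i\<bar> = (\<Sum>j. \<bar>\<beta> j\<bar>) / sqrt d\<close> on the support of
  \<open>\<alpha>\<close>, and symmetrically for \<open>\<beta>\<close>. Summing again over the supports yields
  that the product of the support sizes is exactly \<open>d\<close>. If one of them exceeds \<open>d / 2\<close>, the other
  one is \<open>1\<close>, so that the state is a basis vector up to a phase.
\<close>

lemma cinner_zero_right [simp]: "cinner x (0 :: 'a :: complex_hilbert_space) = 0"
  using cinner_add_right[of x 0 0] by simp

lemma cinner_diff_right:
  "cinner x (y - z) = cinner x y - cinner x (z :: 'a :: complex_hilbert_space)"
  using cinner_add_right[of x "y - z" z] by simp

lemma cinner_sum_right:
  "cinner x (\<Sum>i\<in>I. f i) = (\<Sum>i\<in>I. cinner x (f i :: 'a :: complex_hilbert_space))"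
  by (induction I rule: infinite_finite_induct) (simp_all add: cinner_add_right)

lemma cmod_cinner_commute: "cmod (cinner x y) = cmod (cinner y x)"
  by (metis cinner_commute complex_mod_cnj)

text \<open>The residual \<open>z\<close> is orthogonal to every basis vector, hence to their span.
  The span is the whole space, so \<open>z\<close> is orthogonal to itself and vanishes.\<close>

lemma orthonormal_basis_expansion:
  assumes "orthonormal_basis d b"
  shows "x = (\<Sum>j<d. cinner (b j) x *\<^sub>C b j)"
proof -
  define z where "z = x - (\<Sum>j<d. cinner (b j) x *\<^sub>C b j)"
  have orth: "cinner (b k) z = 0" if "k < d" for k
  proof -
    have "(\<Sum>j<d. cinner (b j) x * cinner (b k) (b j))
        = (\<Sum>j<d. if j = k then cinner (b k) x else 0)"
      using assms that by (intro sum.cong) (auto simp: orthonormal_basis_def)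
    then show ?thesis
      using that
      by (simp add: z_def cinner_diff_right cinner_sum_right cinner_scaleC_right)
  qed
  have "z \<in> cspan (b ` {..<d})"
    using assms by (simp add: orthonormal_basis_def)
  then have "cinner z z = 0"
  proof (rule complex_vector.span_induct[where P = "\<lambda>y. cinner z y = 0"])
    show "complex_vector.subspace {y. cinner z y = 0}"
      by (simp add: complex_vector.subspace_def cinner_add_right cinner_scaleC_right)
    show "cinner z y = 0" if "y \<in> b ` {..<d}" for y
      using that orth by (metis cinner_commute complex_cnj_zero imageE lessThan_iff)
  qed
  then show ?thesis
    by (simp add: cinner_self z_def)
qed

lemma orthonormal_basis_parseval:
  assumes "orthonormal_basis d b"
  shows "cinner x y = (\<Sum>j<d. cinner x (b j) * cinner (b j) y)"
proof -
  have "cinner x y = cinner x (\<Sum>j<d. cinner (b j) y *\<^sub>C b j)"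
    by (rule arg_cong[where f = "cinner x"]) (rule orthonormal_basis_expansion[OF assms])
  then show ?thesis
    by (simp add: cinner_sum_right cinner_scaleC_right mult.commute)
qed

text \<open>Exchanging the bases conjugates each entry of the distribution, and conjugation fixes
  the nonnegative reals. This lets every row statement be reused for columns.\<close>

lemma kd_classical_swap:
  assumes "kd_classical d a b \<psi>"
  shows "kd_classical d b a \<psi>"
proof -
  have "kd_distribution b a \<psi> j i = cnj (kd_distribution a b \<psi> i j)" for i j
    unfolding kd_distribution_def complex_cnj_mult
    by (simp add: cinner_commute[symmetric])
  then show ?thesis
    using assms by (simp add: kd_classical_def complex_is_Real_iff)
qed

lemma kd_classical_cmod_coefficient:
  assumes b: "orthonormal_basis d b"
    and unbiased: "\<And>j. j < d \<Longrightarrow> cmod (cinner (a i) (b j)) = 1 / sqrt (real d)"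
    and classical: "kd_classical d a b \<psi>"
    and "i < d" and nz: "cinner (a i) \<psi> \<noteq> 0"
  shows "cmod (cinner (a i) \<psi>) = (\<Sum>j<d. cmod (cinner (b j) \<psi>)) / sqrt (real d)"
proof -
  let ?\<alpha> = "cinner (a i) \<psi>"
  let ?B = "\<Sum>j<d. cmod (cinner (b j) \<psi>)"
  have entry: "kd_distribution a b \<psi> i j
      = complex_of_real (cmod ?\<alpha> * cmod (cinner (b j) \<psi>) / sqrt (real d))" if "j < d" for j
  proof -
    \<comment> \<open>Classicality enters here: a complex number that is real and nonnegative equals
      its own modulus.\<close>
    have "kd_distribution a b \<psi> i j = complex_of_real (cmod (kd_distribution a b \<psi> i j))"
      using classical \<open>i < d\<close> that
      by (auto simp: kd_classical_def complex_eq_iff complex_is_Real_iff cmod_def)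
    also have "cmod (kd_distribution a b \<psi> i j)
        = cmod ?\<alpha> * cmod (cinner (b j) \<psi>) / sqrt (real d)"
      using unbiased[OF that]
      by (simp add: kd_distribution_def norm_mult cmod_cinner_commute[of \<psi>]
          cmod_cinner_commute[of "b j" "a i"])
    finally show ?thesis .
  qed
  have "complex_of_real ((cmod ?\<alpha>)\<^sup>2) = ?\<alpha> * cinner \<psi> (a i)"
    by (subst cinner_commute[of \<psi>]) (rule complex_norm_square)
  \<comment> \<open>The row sum is the marginal at \<open>a i\<close>: inserting the basis
    \<open>b\<close> into \<open>cinner \<psi> (a i)\<close> produces exactly the entries of row
    \<open>i\<close>.\<close>
  also have "\<dots> = (\<Sum>j<d. kd_distribution a b \<psi> i j)"
    by (simp add: orthonormal_basis_parseval[OF b, of \<psi> "a i"] kd_distribution_def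
        sum_distrib_left mult.assoc)
  also have "\<dots> = complex_of_real (cmod ?\<alpha> * (?B / sqrt (real d)))"
    by (simp add: entry sum_distrib_left sum_divide_distrib)
  finally have "cmod ?\<alpha> * cmod ?\<alpha> = cmod ?\<alpha> * (?B / sqrt (real d))"
    unfolding power2_eq_square of_real_eq_iff .
  \<comment> \<open>One factor \<open>cmod ?\<alpha>\<close> cancels because \<open>i\<close> lies
    in the support.\<close>
  then show ?thesis
    using nz by (simp only: mult_cancel_left norm_eq_zero) simp
qed

text \<open>Only the support contributes to the sum, and there all moduli share one value that does
  not depend on \<open>i\<close>.\<close>

lemma kd_classical_sum_cmod:
  assumes "orthonormal_basis d b"
    and "\<And>i j. i < d \<Longrightarrow> j < d \<Longrightarrow> cmod (cinner (a i) (b j)) = 1 / sqrt (real d)"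
    and "kd_classical d a b \<psi>"
  shows "(\<Sum>i<d. cmod (cinner (a i) \<psi>))
    = real (support_size d a \<psi>) * ((\<Sum>j<d. cmod (cinner (b j) \<psi>)) / sqrt (real d))"
proof -
  let ?S = "{i. i < d \<and> cinner (a i) \<psi> \<noteq> 0}"
  have "(\<Sum>i<d. cmod (cinner (a i) \<psi>)) = (\<Sum>i\<in>?S. cmod (cinner (a i) \<psi>))"
    by (rule sum.mono_neutral_right) auto
  also have "\<dots> = (\<Sum>i\<in>?S. (\<Sum>j<d. cmod (cinner (b j) \<psi>)) / sqrt (real d))"
    using assms by (intro sum.cong refl kd_classical_cmod_coefficient) auto
  finally show ?thesis
    by (simp add: support_size_def)
qed

text \<open>With m and n the support sizes, the coefficient sums satisfy A = m B / sqrt d and B = n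
  A / sqrt d. Eliminating B gives A d = A m n, and A is nonzero because the state is.\<close>

lemma kd_classical_support_size_mult:
  assumes a: "orthonormal_basis d a" and b: "orthonormal_basis d b"
    and unbiased: "\<And>i j. i < d \<Longrightarrow> j < d \<Longrightarrow> cmod (cinner (a i) (b j)) = 1 / sqrt (real d)"
    and classical: "kd_classical d a b \<psi>" and "\<psi> \<noteq> 0"
  shows "support_size d a \<psi> * support_size d b \<psi> = d"
proof -
  define A where "A = (\<Sum>i<d. cmod (cinner (a i) \<psi>))"
  define B where "B = (\<Sum>j<d. cmod (cinner (b j) \<psi>))"
  have "A \<noteq> 0"
  proof
    assume "A = 0"
    then have "\<forall>i<d. cinner (a i) \<psi> = 0"
      by (simp add: A_def sum_nonneg_eq_0_iff)
    then have "cinner \<psi> \<psi> = 0"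
      by (simp add: orthonormal_basis_parseval[OF a, of \<psi> \<psi>])
    then show False
      using \<open>\<psi> \<noteq> 0\<close> by (simp add: cinner_self)
  qed
  \<comment> \<open>For d = 0 the sum \<open>A\<close> would be empty, hence zero; positivity of d
    is what allows clearing the denominators below.\<close>
  then have "d > 0"
    by (auto simp: A_def intro: Nat.gr0I)
  have "A = real (support_size d a \<psi>) * (B / sqrt (real d))"
    unfolding A_def B_def by (rule kd_classical_sum_cmod[OF b unbiased classical])
  also have "B = real (support_size d b \<psi>) * (A / sqrt (real d))"
    unfolding A_def B_def
    by (rule kd_classical_sum_cmod[OF a _ kd_classical_swap[OF classical]])
      (simp add: cmod_cinner_commute[of "b _"] unbiased)
  finally have "A * real d = A * real (support_size d a \<psi> * support_size d b \<psi>)"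
    using \<open>d > 0\<close> by (simp add: field_simps)
  then show ?thesis
    using \<open>A \<noteq> 0\<close> by (simp only: mult_cancel_left of_nat_eq_iff) simp
qed

text \<open>The basis expansion collapses to a single term, and normalization forces its coefficient
  to have modulus 1.\<close>

lemma support_size_eq_1_imp_phase:
  assumes b: "orthonormal_basis d b" and "norm \<psi> = 1" and "support_size d b \<psi> = 1"
  shows "\<exists>j<d. eq_up_to_phase \<psi> (b j)"
proof -
  obtain j where T: "{j. j < d \<and> cinner (b j) \<psi> \<noteq> 0} = {j}"
    using assms(3) unfolding support_size_def by (elim card_1_singletonE)
  then have "j < d" and zero: "\<And>k. k < d \<Longrightarrow> k \<noteq> j \<Longrightarrow> cinner (b k) \<psi> = 0"
    by blast+
  have "\<psi> = (\<Sum>k<d. cinner (b k) \<psi> *\<^sub>C b k)"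
    by (rule orthonormal_basis_expansion[OF b])
  also have "\<dots> = (\<Sum>k\<in>{j}. cinner (b k) \<psi> *\<^sub>C b k)"
    using \<open>j < d\<close> zero by (intro sum.mono_neutral_right) auto
  finally have exp: "\<psi> = cinner (b j) \<psi> *\<^sub>C b j"
    by simp
  have "cinner \<psi> \<psi> = cinner (b j) \<psi> * cinner \<psi> (b j)"
    by (subst (2) exp) (rule cinner_scaleC_right)
  then have "cmod (cinner \<psi> \<psi>) = (cmod (cinner (b j) \<psi>))\<^sup>2"
    by (simp add: norm_mult cmod_cinner_commute[of \<psi> "b j"] power2_eq_square)
  \<comment> \<open>The square is 1, and the root -1 is excluded since a modulus is
    nonnegative.\<close>
  then have "cmod (cinner (b j) \<psi>) = 1"
    using \<open>norm \<psi> = 1\<close> by (simp add: cinner_self power2_eq_1_iff)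
      (smt (verit) norm_ge_zero)
  then show ?thesis
    using exp \<open>j < d\<close> unfolding eq_up_to_phase_def by blast
qed

text \<open>From m n = d < 2 m follows n < 2, while n = 0 would make d zero.\<close>

lemma eq_1_if_mult_eq_gt_half:
  fixes m n d :: nat
  assumes "m * n = d" "d \<ge> 1" "real m > real d / 2"
  shows "n = 1"
proof -
  have "m * n < m * 2"
    using assms by linarith
  then have "n < 2" by simp
  moreover have "n \<noteq> 0" using assms by auto
  ultimately show ?thesis by simp
qed

theorem theorem5:
  fixes d :: nat
    and a b :: "nat \<Rightarrow> 'h :: complex_hilbert_space"
    and \<psi> :: 'h
  assumes "d \<ge> 1"
    and "cdim (UNIV :: 'h set) = d"
    and "orthonormal_basis d a"
    and "orthonormal_basis d b"
    and "\<forall>i<d. \<forall>j<d. cmod (cinner (a i) (b j)) = 1 / sqrt (real d)"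
    and "norm \<psi> = 1"
    and "\<not> (\<exists>i<d. eq_up_to_phase \<psi> (a i))"
    and "\<not> (\<exists>j<d. eq_up_to_phase \<psi> (b j))"
    and "real (support_size d a \<psi>) > real d / 2 \<or> real (support_size d b \<psi>) > real d / 2"
  shows "kd_nonclassical d a b \<psi>"
proof -
  have False if classical: "kd_classical d a b \<psi>"
  proof -
    \<comment> \<open>Normalization supplies the condition that the state is nonzero.\<close>
    have prod: "support_size d a \<psi> * support_size d b \<psi> = d"
      using assms(5,6) by (intro kd_classical_support_size_mult assms classical) auto
    from assms(9) show False
    proof
      assume "real (support_size d a \<psi>) > real d / 2"
      then have "support_size d b \<psi> = 1"
        by (rule eq_1_if_mult_eq_gt_half[OF prod \<open>d \<ge> 1\<close>])
      then show False
        using support_size_eq_1_imp_phase assms(4,6,8) by blast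
    next
      assume "real (support_size d b \<psi>) > real d / 2"
      then have "support_size d a \<psi> = 1"
        by (rule eq_1_if_mult_eq_gt_half[OF trans[OF mult.commute prod] \<open>d \<ge> 1\<close>])
      then show False
        using support_size_eq_1_imp_phase assms(3,6,7) by blast
    qed
  qed
  then show ?thesis
    by (auto simp: kd_nonclassical_def)
qed

end
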